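(* Let $k$ be a field of characteristic zero, let $R=k[[x_1,\ldots,x_n]]$ with maximal ideal $\mathfrak m=(x_1,\ldots,x_n)$, and let $f\in\mathfrak m$. Let $J_f=(\partial_1 f,\ldots,\partial_n f)$. If $J_f$ is $\mathfrak m$-primary, then $$J_f:f\not\subseteq (J_f,f)+\mathfrak m\,(J_f:f).$$ In particular, $J_f:f\not\subseteq (J_f,f)$.
   Context: $\partial_i f$ is the formal partial derivative of $f$ with respect to $x_i$. $J_f:f=\{g\in R: gf\in J_f\}$ is the colon ideal, and $(J_f,f)=J_f+fR$. *)

theory Defs
  imports Complex_Main "HOL-Library.Poly_Mapping" "HOL-Library.Set_Algebras"
begin

section \<open>Multivariate formal power series\<close>

text \<open>
  A series is given by its coefficient function on monomials, and
  a monomial by its exponent vector, a finitely supported function on the type \<open>'v\<close> of variables.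
  For \<open>'v\<close> of class \<open>finite\<close> and cardinality $n$ this is $k[[x_1,\ldots,x_n]]$.
\<close>

typedef ('v, 'k) mfps = "UNIV :: (('v \<Rightarrow>\<^sub>0 nat) \<Rightarrow> 'k) set"
  morphisms mfps_coeff Abs_mfps
  by simp

lemma mfps_coeff_Abs [simp]: "mfps_coeff (Abs_mfps c) = c"
  by (simp add: Abs_mfps_inverse)

lemma mfps_eqI: "(\<And>\<alpha>. mfps_coeff f \<alpha> = mfps_coeff g \<alpha>) \<Longrightarrow> f = g"
  by (metis ext mfps_coeff_inject)

definition splits :: "('v \<Rightarrow>\<^sub>0 nat) \<Rightarrow> (('v \<Rightarrow>\<^sub>0 nat) \<times> ('v \<Rightarrow>\<^sub>0 nat)) set"
  where "splits \<alpha> = {(\<beta>, \<gamma>). \<beta> + \<gamma> = \<alpha>}"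

lemma finite_splits [simp]: "finite (splits \<alpha>)"
proof -
  define S where "S = {h. \<forall>x. (x \<in> Poly_Mapping.keys \<alpha> \<longrightarrow> h x \<in> {..Max (insert 0 (Poly_Mapping.lookup \<alpha> ` Poly_Mapping.keys \<alpha>))})
      \<and> (x \<notin> Poly_Mapping.keys \<alpha> \<longrightarrow> h x = 0)}"
  define B where "B = {\<beta>. \<exists>\<gamma>. \<beta> + \<gamma> = \<alpha>}"
  have "finite S"
    unfolding S_def by (rule finite_set_of_finite_funs) auto
  moreover have "Poly_Mapping.lookup ` B \<subseteq> S"
  proof
    fix h assume "h \<in> Poly_Mapping.lookup ` B"
    then obtain \<beta> \<gamma> where h: "h = Poly_Mapping.lookup \<beta>" and s: "\<beta> + \<gamma> = \<alpha>" by (auto simp: B_def)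
    have le: "h x \<le> Poly_Mapping.lookup \<alpha> x" for x
      using s by (auto simp: h lookup_add)
    have "h x \<le> Max (insert 0 (Poly_Mapping.lookup \<alpha> ` Poly_Mapping.keys \<alpha>))" if "x \<in> Poly_Mapping.keys \<alpha>" for x
      by (rule order.trans[OF le[of x]], rule Max_ge) (use that in auto)
    moreover have "h x = 0" if "x \<notin> Poly_Mapping.keys \<alpha>" for x
      using le[of x] that by (simp add: in_keys_iff)
    ultimately show "h \<in> S" by (auto simp: S_def)
  qed
  ultimately have "finite (Poly_Mapping.lookup ` B)" by (rule rev_finite_subset)
  then have fB: "finite B"
    by (rule finite_imageD) (auto intro!: inj_onI poly_mapping_eqI)
  have "splits \<alpha> \<subseteq> B \<times> B"
    by (auto simp: splits_def B_def) (metis add.commute)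
  then show ?thesis using fB by (meson finite_SigmaI finite_subset)
qed

instantiation mfps :: (type, comm_ring_1) comm_ring_1
begin

definition zero_mfps_def: "0 = Abs_mfps (\<lambda>_. 0)"
definition one_mfps_def: "1 = Abs_mfps (\<lambda>\<alpha>. if \<alpha> = 0 then 1 else 0)"
definition plus_mfps_def: "f + g = Abs_mfps (\<lambda>\<alpha>. mfps_coeff f \<alpha> + mfps_coeff g \<alpha>)"
definition uminus_mfps_def: "- f = Abs_mfps (\<lambda>\<alpha>. - mfps_coeff f \<alpha>)"
definition minus_mfps_def: "f - g = Abs_mfps (\<lambda>\<alpha>. mfps_coeff f \<alpha> - mfps_coeff g \<alpha>)"
definition times_mfps_def:
  "f * g = Abs_mfps (\<lambda>\<alpha>. \<Sum>(\<beta>, \<gamma>)\<in>splits \<alpha>. mfps_coeff f \<beta> * mfps_coeff g \<gamma>)"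

lemmas mfps_coeff_simps =
  zero_mfps_def one_mfps_def plus_mfps_def uminus_mfps_def minus_mfps_def times_mfps_def

instance
proof
  fix f g h :: "('a, 'b) mfps"
  show "f + g + h = f + (g + h)" "f + g = g + f" "0 + f = f" "- f + f = 0" "f - g = f + - g"
    by (auto intro!: mfps_eqI simp: mfps_coeff_simps algebra_simps)
  show "(f + g) * h = f * h + g * h"
    by (auto intro!: mfps_eqI simp: mfps_coeff_simps algebra_simps sum.distrib split_def)
  show "f * g = g * f"
  proof (rule mfps_eqI, simp add: mfps_coeff_simps)
    fix \<alpha> :: "'a \<Rightarrow>\<^sub>0 nat"
    show "(\<Sum>(\<beta>, \<gamma>)\<in>splits \<alpha>. mfps_coeff f \<beta> * mfps_coeff g \<gamma>)
        = (\<Sum>(\<beta>, \<gamma>)\<in>splits \<alpha>. mfps_coeff g \<beta> * mfps_coeff f \<gamma>)"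
      by (rule sum.reindex_bij_witness[of _ prod.swap prod.swap])
         (auto simp: splits_def add.commute mult.commute)
  qed
  show "1 * f = f"
  proof (rule mfps_eqI, simp add: mfps_coeff_simps)
    fix \<alpha> :: "'a \<Rightarrow>\<^sub>0 nat"
    have "(\<Sum>(\<beta>, \<gamma>)\<in>splits \<alpha>. (if \<beta> = 0 then 1 else 0) * mfps_coeff f \<gamma>)
        = (\<Sum>(\<beta>, \<gamma>)\<in>{(0 :: 'a \<Rightarrow>\<^sub>0 nat, \<alpha>)}. (if \<beta> = 0 then 1 else 0) * mfps_coeff f \<gamma>)"
      by (rule sum.mono_neutral_right[OF finite_splits]) (auto simp: splits_def split: if_splits)
    then show "(\<Sum>(\<beta>, \<gamma>)\<in>splits \<alpha>. (if \<beta> = 0 then 1 else 0) * mfps_coeff f \<gamma>) = mfps_coeff f \<alpha>"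
      by simp
  qed
  show "f * g * h = f * (g * h)"
  proof (rule mfps_eqI, simp add: mfps_coeff_simps)
    fix \<alpha> :: "'a \<Rightarrow>\<^sub>0 nat"
    let ?c = "\<lambda>\<beta> \<gamma> \<delta>. mfps_coeff f \<beta> * mfps_coeff g \<gamma> * mfps_coeff h \<delta>"
    have "(\<Sum>(\<beta>, \<gamma>)\<in>splits \<alpha>. (\<Sum>(\<delta>, \<epsilon>)\<in>splits \<beta>. mfps_coeff f \<delta> * mfps_coeff g \<epsilon>) * mfps_coeff h \<gamma>)
        = (\<Sum>p\<in>splits \<alpha>. \<Sum>q\<in>splits (fst p). ?c (fst q) (snd q) (snd p))"
      by (simp add: split_def sum_distrib_right)
    also have "\<dots> = (\<Sum>(p, q)\<in>Sigma (splits \<alpha>) (\<lambda>p. splits (fst p)). ?c (fst q) (snd q) (snd p))"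
      by (rule sum.Sigma) auto
    also have "\<dots> = (\<Sum>(p, q)\<in>Sigma (splits \<alpha>) (\<lambda>p. splits (snd p)). ?c (fst p) (fst q) (snd q))"
      by (rule sum.reindex_bij_witness
          [of _ "\<lambda>((a, _), (b, c)). ((a + b, c), (a, b))" "\<lambda>((_, c), (a, b)). ((a, b + c), (b, c))"])
         (auto simp: splits_def add.assoc)
    also have "\<dots> = (\<Sum>p\<in>splits \<alpha>. \<Sum>q\<in>splits (snd p). ?c (fst p) (fst q) (snd q))"
      by (rule sum.Sigma[symmetric]) auto
    also have "\<dots> = (\<Sum>(\<beta>, \<gamma>)\<in>splits \<alpha>. mfps_coeff f \<beta> * (\<Sum>(\<delta>, \<epsilon>)\<in>splits \<gamma>. mfps_coeff g \<delta> * mfps_coeff h \<epsilon>))"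
      by (simp add: split_def sum_distrib_left mult.assoc)
    finally show "(\<Sum>(\<beta>, \<gamma>)\<in>splits \<alpha>. (\<Sum>(\<delta>, \<epsilon>)\<in>splits \<beta>. mfps_coeff f \<delta> * mfps_coeff g \<epsilon>) * mfps_coeff h \<gamma>)
        = (\<Sum>(\<beta>, \<gamma>)\<in>splits \<alpha>. mfps_coeff f \<beta> * (\<Sum>(\<delta>, \<epsilon>)\<in>splits \<gamma>. mfps_coeff g \<delta> * mfps_coeff h \<epsilon>))" .
  qed
  show "(0 :: ('a, 'b) mfps) \<noteq> 1"
  proof
    assume "(0 :: ('a, 'b) mfps) = 1"
    then have "mfps_coeff (0 :: ('a, 'b) mfps) 0 = mfps_coeff 1 0" by simp
    then show False by (simp add: mfps_coeff_simps)
  qed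
qed

end

definition mfps_X :: "'v \<Rightarrow> ('v, 'k::comm_ring_1) mfps"
  where "mfps_X i = Abs_mfps (\<lambda>\<alpha>. if \<alpha> = Poly_Mapping.single i 1 then 1 else 0)"

text \<open>
  The coefficient of $x^\alpha$ in $\partial_i f$ is $(\alpha_i + 1)$ times the coefficient of
  $x^{\alpha + e_i}$ in $f$.
\<close>

definition mfps_pderiv :: "'v \<Rightarrow> ('v, 'k::comm_ring_1) mfps \<Rightarrow> ('v, 'k) mfps"
  where "mfps_pderiv i f = Abs_mfps (\<lambda>\<alpha>.
    of_nat (Poly_Mapping.lookup \<alpha> i + 1) * mfps_coeff f (\<alpha> + Poly_Mapping.single i 1))"


section \<open>Ideals\<close>

text \<open>
  A commutative ring is a module over itself; its submodules (\<open>ring_ideal.subspace\<close>) are the ideals,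
  and \<open>ring_ideal.span S\<close> is the ideal generated by \<open>S\<close>. Sums of ideals are the elementwise sums of
  \<^theory>\<open>HOL-Library.Set_Algebras\<close>; that theory's elementwise product is not the product of ideals.
\<close>

interpretation ring_ideal: module "(*) :: 'a::comm_ring_1 \<Rightarrow> 'a \<Rightarrow> 'a"
  by standard (simp_all add: algebra_simps)

definition ideal_product :: "'a::comm_ring_1 set \<Rightarrow> 'a set \<Rightarrow> 'a set"
  where "ideal_product I J = ring_ideal.span {a * b | a b. a \<in> I \<and> b \<in> J}"

definition colon_ideal :: "'a::comm_ring_1 set \<Rightarrow> 'a \<Rightarrow> 'a set"
  where "colon_ideal I f = {g. g * f \<in> I}"

definition ideal_radical :: "'a::comm_ring_1 set \<Rightarrow> 'a set"
  where "ideal_radical I = {a. \<exists>m. a ^ m \<in> I}"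

definition primary_ideal :: "'a::comm_ring_1 set \<Rightarrow> bool"
  where "primary_ideal Q \<longleftrightarrow> ring_ideal.subspace Q \<and> Q \<noteq> UNIV
    \<and> (\<forall>a b. a * b \<in> Q \<longrightarrow> a \<in> Q \<or> (\<exists>m. b ^ m \<in> Q))"

text \<open>The first argument is the radical: \<open>ideal_primary_to P Q\<close> says that \<open>Q\<close> is \<open>P\<close>-primary.\<close>

definition ideal_primary_to :: "'a::comm_ring_1 set \<Rightarrow> 'a set \<Rightarrow> bool"
  where "ideal_primary_to P Q \<longleftrightarrow> primary_ideal Q \<and> ideal_radical Q = P"

definition mfps_maximal_ideal :: "('v, 'k::comm_ring_1) mfps set"
  where "mfps_maximal_ideal = ring_ideal.span (range mfps_X)"

definition jacobian_ideal :: "('v, 'k::comm_ring_1) mfps \<Rightarrow> ('v, 'k) mfps set"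
  where "jacobian_ideal f = ring_ideal.span (range (\<lambda>i. mfps_pderiv i f))"

text \<open>$(J_f, f) = J_f + fR$\<close>

definition tjurina_ideal :: "('v, 'k::comm_ring_1) mfps \<Rightarrow> ('v, 'k) mfps set"
  where "tjurina_ideal f = jacobian_ideal f + range (\<lambda>r. f * r)"

end

theory Submission
  imports Defs
begin

text \<open>
  Suppose $J_f : f \subseteq L = (J_f, f)$. Then in $gv \equiv s(gv) + f P_g(v)$ modulo $J_f$, where
  $v$ runs through a $k$-linear complement of $L$ in $R$ with projection $s$, the operator $P_g$ on
  the finite-dimensional space $R/L$ is well defined. It satisfies $P_{gh} = g P_h + P_g h$ and
  $P_f = 1$. By cyclicity of the trace, $g \mapsto (h \mapsto \mathrm{tr}(P_g h))$ is a derivation into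
  the dual of $R/L$, hence obeys the chain rule and maps $f$ to
  $\sum_i \partial_i f \cdot \mathrm{tr}(P_{x_i} \,\cdot\,) = 0$ because $J_f$ kills $R/L$. But its
  value at $f$ and $h = 1$ is $\dim_k R/L \neq 0$ in characteristic zero. The stronger
  non-inclusion follows by Nakayama's lemma.
\<close>

text \<open>This instance of a module law is associativity in reverse and loops with \<open>mult.assoc\<close>.\<close>

declare ring_ideal.scale_scale [simp del]

section \<open>Bases modulo an ideal\<close>

text \<open>A spanning set of least cardinality modulo \<open>I\<close> is a basis of R/I, and
  uniqueness of coordinates yields every property of \<open>c\<close>. The scalars enter through a
  ring homomorphism \<open>C\<close>, so that linear algebra over k can be done inside the
  ring.\<close>

lemma quotient_basis:
  fixes C :: "'k::field \<Rightarrow> 'a::comm_ring_1"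
  assumes C_add: "\<And>a b. C (a + b) = C a + C b" and C_mult: "\<And>a b. C (a * b) = C a * C b"
    and C_1: "C 1 = 1"
    and I: "ring_ideal.subspace I"
    and S: "finite S" "\<And>r. \<exists>c. r - (\<Sum>s\<in>S. C (c s) * s) \<in> I"
  obtains B c where "finite B"
    and "\<And>r. r - (\<Sum>b\<in>B. C (c r b) * b) \<in> I"
    and "\<And>r r' b. r - r' \<in> I \<Longrightarrow> b \<in> B \<Longrightarrow> c r b = c r' b"
    and "\<And>r r' b. b \<in> B \<Longrightarrow> c (r + r') b = c r b + c r' b"
    and "\<And>a r b. b \<in> B \<Longrightarrow> c (C a * r) b = a * c r b"
    and "\<And>b. b \<in> B \<Longrightarrow> c b b = 1"
proof -
  have C_0: "C 0 = 0" using C_add[of 0 0] by simp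
  have C_diff: "C (a - b) = C a - C b" for a b using C_add[of "a - b" b] by simp
  let ?spans = "\<lambda>B. finite B \<and> (\<forall>r. \<exists>c. r - (\<Sum>s\<in>B. C (c s) * s) \<in> I)"
  have "?spans S" using S by blast
  then obtain B where B: "?spans B" and least: "\<And>B'. ?spans B' \<Longrightarrow> card B \<le> card B'"
    using ex_has_least_nat[of ?spans S card] by blast
  have fin: "finite B" using B by blast
  from B have "\<forall>r. \<exists>c. r - (\<Sum>s\<in>B. C (c s) * s) \<in> I" by blast
  then obtain c where c: "\<And>r. r - (\<Sum>s\<in>B. C (c r s) * s) \<in> I" by metis
  have indep: "a b0 = 0" if a: "(\<Sum>s\<in>B. C (a s) * s) \<in> I" and b0: "b0 \<in> B" for a b0
  proof (rule ccontr)
    assume nz: "a b0 \<noteq> 0"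
    have "\<exists>d. r - (\<Sum>s\<in>B - {b0}. C (d s) * s) \<in> I" for r
    proof
      \<comment> \<open>Subtracting \<open>q\<close> times the relation cancels the coefficient of
        \<open>b0\<close>. A nontrivial relation would thus leave \<open>B - {b0}\<close> spanning,
        against minimality.\<close>
      define q where "q = c r b0 / a b0"
      define d where "d s = c r s - q * a s" for s
      have d0: "d b0 = 0" using nz by (simp add: d_def q_def)
      have "(\<Sum>s\<in>B - {b0}. C (d s) * s) = (\<Sum>s\<in>B. C (d s) * s)"
        using fin b0 d0 by (simp add: sum.remove[of B b0] C_0)
      also have "\<dots> = (\<Sum>s\<in>B. C (c r s) * s) - C q * (\<Sum>s\<in>B. C (a s) * s)"
        by (simp only: d_def C_diff C_mult left_diff_distrib sum_subtractf sum_distrib_left mult.assoc)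
      finally have eq: "r - (\<Sum>s\<in>B - {b0}. C (d s) * s)
          = (r - (\<Sum>s\<in>B. C (c r s) * s)) + C q * (\<Sum>s\<in>B. C (a s) * s)" by simp
      show "r - (\<Sum>s\<in>B - {b0}. C (d s) * s) \<in> I"
        unfolding eq by (rule ring_ideal.subspace_add[OF I c ring_ideal.subspace_scale[OF I a]])
    qed
    then have "card B \<le> card (B - {b0})" using least fin by blast
    then show False using b0 fin by (metis card_Diff1_less not_le)
  qed
  \<comment> \<open>Two expansions of \<open>r\<close> differ by a relation modulo \<open>I\<close>.
    Each property below follows by exhibiting the expected expansion.\<close>
  have unique: "c r b = d b" if r: "r - (\<Sum>s\<in>B. C (d s) * s) \<in> I" and b: "b \<in> B" for r d b
  proof -
    have eq: "(\<Sum>s\<in>B. C (c r s - d s) * s)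
        = (r - (\<Sum>s\<in>B. C (d s) * s)) - (r - (\<Sum>s\<in>B. C (c r s) * s))"
      by (simp add: C_diff left_diff_distrib sum_subtractf)
    have "(\<Sum>s\<in>B. C (c r s - d s) * s) \<in> I"
      unfolding eq by (rule ring_ideal.subspace_diff[OF I r c])
    from indep[OF this b] show ?thesis by simp
  qed
  show thesis
  proof (rule that[OF fin c])
    fix r r' b assume rr: "r - r' \<in> I" and b: "b \<in> B"
    have eq: "r - (\<Sum>s\<in>B. C (c r' s) * s) = (r - r') + (r' - (\<Sum>s\<in>B. C (c r' s) * s))" by simp
    have "r - (\<Sum>s\<in>B. C (c r' s) * s) \<in> I"
      unfolding eq by (rule ring_ideal.subspace_add[OF I rr c])
    then show "c r b = c r' b" using b by (rule unique)
  next
    fix r r' b assume b: "b \<in> B"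
    have eq: "r + r' - (\<Sum>s\<in>B. C (c r s + c r' s) * s)
        = (r - (\<Sum>s\<in>B. C (c r s) * s)) + (r' - (\<Sum>s\<in>B. C (c r' s) * s))"
      by (simp add: C_add distrib_right sum.distrib)
    have "r + r' - (\<Sum>s\<in>B. C (c r s + c r' s) * s) \<in> I"
      unfolding eq by (rule ring_ideal.subspace_add[OF I c c])
    then show "c (r + r') b = c r b + c r' b" using b by (rule unique)
  next
    fix a r b assume b: "b \<in> B"
    have eq: "C a * r - (\<Sum>s\<in>B. C (a * c r s) * s) = C a * (r - (\<Sum>s\<in>B. C (c r s) * s))"
      by (simp only: C_mult right_diff_distrib mult.assoc sum_distrib_left)
    have "C a * r - (\<Sum>s\<in>B. C (a * c r s) * s) \<in> I"
      unfolding eq by (rule ring_ideal.subspace_scale[OF I c])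
    then show "c (C a * r) b = a * c r b" using b by (rule unique)
  next
    fix b assume b: "b \<in> B"
    have "(\<Sum>s\<in>B. C (if s = b then 1 else 0) * s) = (\<Sum>s\<in>B. if s = b then b else 0)"
      by (rule sum.cong) (auto simp: C_0 C_1)
    also have "\<dots> = b" using fin b by simp
    finally have "b - (\<Sum>s\<in>B. C (if s = b then 1 else 0) * s) \<in> I"
      using ring_ideal.subspace_0[OF I] by simp
    from unique[OF this b] show "c b b = 1" by simp
  qed
qed

section \<open>The trace derivation\<close>

lemma plus_principal_iff:
  fixes J :: "'a::comm_ring_1 set"
  shows "x \<in> J + range (\<lambda>r. f * r) \<longleftrightarrow> (\<exists>j\<in>J. \<exists>r. x = j + f * r)"
  by (auto simp: set_plus_def)

lemma subspace_set_plus: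
  fixes I J :: "'a::comm_ring_1 set"
  assumes I: "ring_ideal.subspace I" and J: "ring_ideal.subspace J"
  shows "ring_ideal.subspace (I + J)"
proof (rule ring_ideal.subspaceI)
  show "0 \<in> I + J"
    using set_plus_intro[OF ring_ideal.subspace_0[OF I] ring_ideal.subspace_0[OF J]] by simp
next
  fix x y assume "x \<in> I + J" "y \<in> I + J"
  then obtain i j i' j' where i: "i \<in> I" "i' \<in> I" and j: "j \<in> J" "j' \<in> J"
    and "x = i + j" "y = i' + j'"
    unfolding set_plus_def by blast
  then have "x + y = (i + i') + (j + j')" by simp
  then show "x + y \<in> I + J"
    using ring_ideal.subspace_add[OF I i] ring_ideal.subspace_add[OF J j] by (simp add: set_plus_intro)
next
  fix a x assume "x \<in> I + J"
  then obtain i j where i: "i \<in> I" and j: "j \<in> J" and "x = i + j"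
    unfolding set_plus_def by blast
  then have "a * x = a * i + a * j" by (simp add: distrib_left)
  then show "a * x \<in> I + J"
    using ring_ideal.subspace_scale[OF I i] ring_ideal.subspace_scale[OF J j] by (simp add: set_plus_intro)
qed

lemma subspace_plus_principal:
  fixes J :: "'a::comm_ring_1 set"
  assumes J: "ring_ideal.subspace J"
  shows "ring_ideal.subspace (J + range (\<lambda>r. f * r))"
proof (rule subspace_set_plus[OF J], rule ring_ideal.subspaceI)
  show "0 \<in> range (\<lambda>r. f * r)" by (rule range_eqI[of _ _ 0]) simp
next
  fix x y assume "x \<in> range (\<lambda>r. f * r)" "y \<in> range (\<lambda>r. f * r)"
  then show "x + y \<in> range (\<lambda>r. f * r)" by (auto simp: distrib_left[symmetric])
next
  fix a x assume "x \<in> range (\<lambda>r. f * r)"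
  then show "a * x \<in> range (\<lambda>r. f * r)" by (auto simp: mult.left_commute[of a])
qed

text \<open>
  In a basis of $R/(J, f)$ with coordinates \<open>c\<close>, \<open>e (g * b)\<close> is the column of $P_g$ at \<open>b\<close>
  and \<open>\<Lambda> g h\<close> is the trace of $P_g h$.
\<close>

lemma trace_derivation:
  fixes C :: "'k::field \<Rightarrow> 'a::comm_ring_1"
  assumes C_add: "\<And>a b. C (a + b) = C a + C b" and C_mult: "\<And>a b. C (a * b) = C a * C b"
    and C_1: "C 1 = 1"
    and J: "ring_ideal.subspace J"
    and proper: "1 \<notin> J + range (\<lambda>r. f * r)"
    and colon: "colon_ideal J f \<subseteq> J + range (\<lambda>r. f * r)"
    and S: "finite S" "\<And>r. \<exists>c. r - (\<Sum>s\<in>S. C (c s) * s) \<in> J"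
  obtains \<Lambda> :: "'a \<Rightarrow> 'a \<Rightarrow> 'k" and d where
    "\<And>g g' h. \<Lambda> (g + g') h = \<Lambda> g h + \<Lambda> g' h"
    "\<And>a g h. \<Lambda> (C a * g) h = a * \<Lambda> g h"
    "\<And>g h h'. \<Lambda> g (h + h') = \<Lambda> g h + \<Lambda> g h'"
    "\<And>a g h. \<Lambda> g (C a * h) = a * \<Lambda> g h"
    "\<And>g g' h. \<Lambda> (g * g') h = \<Lambda> g (g' * h) + \<Lambda> g' (g * h)"
    "\<And>g h. h \<in> J \<Longrightarrow> \<Lambda> g h = 0"
    "\<Lambda> f 1 = of_nat d" "d > 0"
proof -
  define L where "L = J + range (\<lambda>r. f * r)"
  have L: "ring_ideal.subspace L" unfolding L_def by (rule subspace_plus_principal[OF J])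
  have L_iff: "x \<in> L \<longleftrightarrow> (\<exists>j\<in>J. \<exists>r. x = j + f * r)" for x
    unfolding L_def by (rule plus_principal_iff)
  have JL: "j \<in> L" if "j \<in> J" for j
  proof -
    have "j = j + f * 0" by simp
    with that show ?thesis unfolding L_iff by blast
  qed
  have fL: "f * r \<in> L" for r
  proof -
    have "f * r = 0 + f * r" by simp
    with ring_ideal.subspace_0[OF J] show ?thesis unfolding L_iff by blast
  qed
  \<comment> \<open>The inclusion to be refuted enters here: \<open>f * r\<close> modulo
    \<open>J\<close> determines \<open>r\<close> modulo \<open>L\<close>.\<close>
  have colonL: "r \<in> L" if "f * r \<in> J" for r
    using that colon by (auto simp: colon_ideal_def L_def mult.commute)
  have S': "\<exists>c. r - (\<Sum>s\<in>S. C (c s) * s) \<in> L" for r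
    using S(2) JL by blast
  obtain B c where fin: "finite B"
    and c: "\<And>r. r - (\<Sum>b\<in>B. C (c r b) * b) \<in> L"
    and c_cong: "\<And>r r' b. r - r' \<in> L \<Longrightarrow> b \<in> B \<Longrightarrow> c r b = c r' b"
    and c_add: "\<And>r r' b. b \<in> B \<Longrightarrow> c (r + r') b = c r b + c r' b"
    and c_scale: "\<And>a r b. b \<in> B \<Longrightarrow> c (C a * r) b = a * c r b"
    and c_basis: "\<And>b. b \<in> B \<Longrightarrow> c b b = 1"
    by (rule quotient_basis[OF C_add C_mult C_1 L S(1) S']) (rule that)
  have C_0: "C 0 = 0" using C_add[of 0 0] by simp
  have c_L: "c r b = 0" if "r \<in> L" "b \<in> B" for r b
    using c_cong[of r 0 b] c_scale[of b 0 0] that by (simp add: C_0)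
  have c_sum: "c (\<Sum>x\<in>X. C (a x) * y x) b = (\<Sum>x\<in>X. a x * c (y x) b)"
    if "b \<in> B" "finite X" for X a y and b
    using that(2) by (induction X rule: finite_induct)
      (use that(1) c_L[OF ring_ideal.subspace_0[OF L]] in \<open>auto simp: c_add c_scale\<close>)
  \<comment> \<open>The k-linear projection with kernel \<open>L\<close> onto the span of
    \<open>B\<close>, a complement of \<open>L\<close>.\<close>
  define s where "s r = (\<Sum>b\<in>B. C (c r b) * b)" for r
  have s: "r - s r \<in> L" for r using c by (simp add: s_def)
  have s_cong: "s r = s r'" if "r - r' \<in> L" for r r'
    unfolding s_def by (rule sum.cong) (use that c_cong in auto)
  have s_add: "s (r + r') = s r + s r'" for r r'
    by (simp add: s_def c_add C_add distrib_right sum.distrib)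
  have s_scale: "s (C a * r) = C a * s r" for a r
    by (simp add: s_def c_scale C_mult mult.assoc sum_distrib_left)
  have s_L: "s r = 0" if "r \<in> L" for r
    unfolding s_def by (rule sum.neutral) (use that c_L in \<open>auto simp: C_0\<close>)
  \<comment> \<open>Modulo \<open>J\<close>, the part of \<open>r\<close> lying in \<open>L\<close>
    is a multiple of \<open>f\<close>; \<open>w\<close> picks a cofactor.\<close>
  have "\<exists>w. r - s r - f * w \<in> J" for r
  proof -
    from s[of r] obtain j v where "j \<in> J" "r - s r = j + f * v" unfolding L_iff by blast
    then show ?thesis by (auto intro!: exI[of _ v])
  qed
  then obtain w where w: "\<And>r. r - s r - f * w r \<in> J" by metis
  define e where "e r = c (w r)" for r
  \<comment> \<open>Independence of the chosen cofactor: two of them differ by an element of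
    \<open>L\<close> by \<open>colonL\<close>. Additivity and homogeneity of \<open>e\<close> follow
    by naming a suitable cofactor.\<close>
  have e_eq: "e r b = c v b" if "r - s r - f * v \<in> J" "b \<in> B" for r v b
  proof -
    have eq: "f * (w r - v) = (r - s r - f * v) - (r - s r - f * w r)"
      by (simp add: algebra_simps)
    have "w r - v \<in> L"
      by (rule colonL) (unfold eq, rule ring_ideal.subspace_diff[OF J that(1) w])
    then show ?thesis unfolding e_def using that(2) by (rule c_cong)
  qed
  have e_add: "e (r + r') b = e r b + e r' b" if "b \<in> B" for r r' b
  proof -
    have eq: "(r + r') - s (r + r') - f * (w r + w r') = (r - s r - f * w r) + (r' - s r' - f * w r')"
      by (simp add: s_add algebra_simps)
    have "(r + r') - s (r + r') - f * (w r + w r') \<in> J"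
      unfolding eq by (rule ring_ideal.subspace_add[OF J w w])
    from e_eq[OF this that] show ?thesis by (simp add: c_add that e_def)
  qed
  have e_scale: "e (C a * r) b = a * e r b" if "b \<in> B" for a r b
  proof -
    have eq: "C a * r - s (C a * r) - f * (C a * w r) = C a * (r - s r - f * w r)"
      by (simp add: s_scale right_diff_distrib mult.left_commute)
    have "C a * r - s (C a * r) - f * (C a * w r) \<in> J"
      unfolding eq by (rule ring_ideal.subspace_scale[OF J w])
    from e_eq[OF this that] show ?thesis by (simp add: c_scale that e_def)
  qed
  \<comment> \<open>The projection kills \<open>f * r\<close>, and \<open>r\<close> itself is a
    cofactor. This is the identity P_f = 1.\<close>
  have e_f: "e (f * r) b = c r b" if "b \<in> B" for r b
    by (rule e_eq[OF _ that]) (simp add: s_L[OF fL] ring_ideal.subspace_0[OF J])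
  have e_J: "e r b = 0" if "r \<in> J" "b \<in> B" for r b
    using e_eq[of r 0 b] c_L[OF ring_ideal.subspace_0[OF L]] that by (simp add: s_L[OF JL])
  have e_sum: "e (\<Sum>x\<in>X. C (a x) * y x) b = (\<Sum>x\<in>X. a x * e (y x) b)"
    if "b \<in> B" "finite X" for X a y and b
    using that(2) by (induction X rule: finite_induct)
      (use that(1) e_J[OF ring_ideal.subspace_0[OF J]] in \<open>auto simp: e_add e_scale\<close>)
  \<comment> \<open>The product \<open>h * b\<close> is projected to the complement before
    multiplying by \<open>g\<close>, because \<open>e\<close> respects congruence modulo
    \<open>J\<close> only.\<close>
  define \<Lambda> where "\<Lambda> g h = (\<Sum>b\<in>B. e (g * s (h * b)) b)" for g h
  have leibniz: "\<Lambda> (g * g') h = \<Lambda> g (g' * h) + \<Lambda> g' (g * h)" for g g' h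
  proof -
    \<comment> \<open>Diagonal entries of P_{gg'} h = P_g g' h + g P_{g'} h. Multiplying y = s(y) +
      f w(y) modulo \<open>J\<close> by \<open>g\<close> gives the two terms; \<open>s y\<close>
      depends only on \<open>g' * h * b\<close> modulo \<open>L\<close>, and expanding
      \<open>w y\<close> in the basis turns the second term into a matrix product.\<close>
    have summand: "e (g * g' * s (h * b)) b
        = e (g * s (g' * h * b)) b + (\<Sum>b'\<in>B. e (g' * s (h * b)) b' * c (g * b') b)"
      if b: "b \<in> B" for b
    proof -
      define y where "y = g' * s (h * b)"
      have eq: "y - g' * h * b = - g' * (h * b - s (h * b))" by (simp add: y_def algebra_simps)
      have sy: "s y = s (g' * h * b)"
        by (rule s_cong) (unfold eq, rule ring_ideal.subspace_scale[OF L s])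
      have "g * g' * s (h * b) = g * (s y) + f * (g * w y) + g * (y - s y - f * w y)"
        by (simp add: y_def algebra_simps)
      then have "e (g * g' * s (h * b)) b = e (g * s y) b + c (g * w y) b"
        using e_J[OF ring_ideal.subspace_scale[OF J w[of y]] b, of g] by (simp add: e_add e_f b)
      also have "c (g * w y) b = c (\<Sum>b'\<in>B. C (e y b') * (g * b')) b"
      proof (rule c_cong[OF _ b])
        have eq: "g * w y - (\<Sum>b'\<in>B. C (e y b') * (g * b')) = g * (w y - s (w y))"
          by (simp add: s_def e_def algebra_simps sum_distrib_left)
        show "g * w y - (\<Sum>b'\<in>B. C (e y b') * (g * b')) \<in> L"
          unfolding eq by (rule ring_ideal.subspace_scale[OF L s])
      qed
      also have "\<dots> = (\<Sum>b'\<in>B. e y b' * c (g * b') b)" by (rule c_sum[OF b fin])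
      finally show ?thesis unfolding sy by (simp only: y_def)
    qed
    \<comment> \<open>Diagonal entries of P_{g'} h g as a product of the same two matrices in the
      opposite order, obtained by expanding \<open>g * b\<close> in the basis.\<close>
    have summand': "e (g' * s (g * h * b)) b = (\<Sum>b'\<in>B. e (g' * s (h * b')) b * c (g * b) b')"
      if b: "b \<in> B" for b
    proof -
      have eq: "g * h * b - (\<Sum>b'\<in>B. C (c (g * b) b') * (h * b')) = h * (g * b - s (g * b))"
        by (simp add: s_def algebra_simps sum_distrib_left)
      have "s (g * h * b) = s (\<Sum>b'\<in>B. C (c (g * b) b') * (h * b'))"
        by (rule s_cong) (unfold eq, rule ring_ideal.subspace_scale[OF L s])
      also have "\<dots> = (\<Sum>b'\<in>B. C (c (g * b) b') * s (h * b'))"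
        using fin by (induction B rule: finite_induct)
          (use s_L[OF ring_ideal.subspace_0[OF L]] in \<open>auto simp: s_add s_scale\<close>)
      finally have "g' * s (g * h * b) = (\<Sum>b'\<in>B. C (c (g * b) b') * (g' * s (h * b')))"
        by (simp add: sum_distrib_left algebra_simps)
      then show ?thesis by (simp add: e_sum[OF b fin] mult.commute)
    qed
    have "\<Lambda> (g * g') h = \<Lambda> g (g' * h) + (\<Sum>b\<in>B. \<Sum>b'\<in>B. e (g' * s (h * b)) b' * c (g * b') b)"
      by (simp add: \<Lambda>_def summand sum.distrib)
    \<comment> \<open>Cyclicity of the trace, tr(AB) = tr(BA), by exchanging the two sums.\<close>
    also have "(\<Sum>b\<in>B. \<Sum>b'\<in>B. e (g' * s (h * b)) b' * c (g * b') b) = \<Lambda> g' (g * h)"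
      unfolding \<Lambda>_def by (subst sum.swap) (simp add: summand')
    finally show ?thesis .
  qed
  have "B \<noteq> {}"
    using c[of 1] proper unfolding L_def by auto
  show thesis
  proof (rule that[of \<Lambda> "card B"])
    show "\<Lambda> (g + g') h = \<Lambda> g h + \<Lambda> g' h" for g g' h
      by (simp add: \<Lambda>_def distrib_right e_add sum.distrib)
    show "\<Lambda> (C a * g) h = a * \<Lambda> g h" for a g h
      by (simp add: \<Lambda>_def mult.assoc e_scale sum_distrib_left)
    show "\<Lambda> g (h + h') = \<Lambda> g h + \<Lambda> g h'" for g h h'
      by (simp add: \<Lambda>_def distrib_right distrib_left s_add e_add sum.distrib)
    show "\<Lambda> g (C a * h) = a * \<Lambda> g h" for a g h
      by (simp add: \<Lambda>_def mult.assoc s_scale mult.left_commute[of g] e_scale sum_distrib_left)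
    show "\<Lambda> g h = 0" if "h \<in> J" for g h
    proof -
      have "s (h * b) = 0" for b
        using s_L[OF JL] ring_ideal.subspace_scale[OF J that, of b] by (simp add: mult.commute)
      then show ?thesis using e_J[OF ring_ideal.subspace_0[OF J]] by (simp add: \<Lambda>_def)
    qed
    \<comment> \<open>Since P_f = 1, these are the diagonal entries whose sum is
      \<open>\<Lambda> f 1\<close>; the trace is therefore the dimension of R/L.\<close>
    have "c (s b) b = 1" if "b \<in> B" for b
      using c_cong[OF s that, of b] c_basis[OF that] by simp
    then show "\<Lambda> f 1 = of_nat (card B)" by (simp add: \<Lambda>_def e_f)
    show "card B > 0" using fin \<open>B \<noteq> {}\<close> by (simp add: card_gt_0_iff)
  qed (rule leibniz)
qed

section \<open>Power series\<close>

lemma mfps_coeff_add [simp]: "mfps_coeff (f + g) \<alpha> = mfps_coeff f \<alpha> + mfps_coeff g \<alpha>"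
  by (simp add: plus_mfps_def)

lemma mfps_coeff_0 [simp]: "mfps_coeff 0 \<alpha> = 0"
  by (simp add: zero_mfps_def)

lemma mfps_coeff_sum: "mfps_coeff (\<Sum>x\<in>X. g x) \<alpha> = (\<Sum>x\<in>X. mfps_coeff (g x) \<alpha>)"
  by (induction X rule: infinite_finite_induct) auto

lemma mfps_coeff_mult:
  "mfps_coeff (f * g) \<alpha> = (\<Sum>(\<beta>, \<gamma>)\<in>splits \<alpha>. mfps_coeff f \<beta> * mfps_coeff g \<gamma>)"
  by (simp add: times_mfps_def)

text \<open>With exponent 0 this is the embedding of k into the power series, which later serves as
  \<open>C\<close>.\<close>

definition mfps_monom :: "('v \<Rightarrow>\<^sub>0 nat) \<Rightarrow> 'k::comm_ring_1 \<Rightarrow> ('v, 'k) mfps"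
  where "mfps_monom \<alpha> c = Abs_mfps (\<lambda>\<beta>. if \<beta> = \<alpha> then c else 0)"

lemma mfps_coeff_monom: "mfps_coeff (mfps_monom \<alpha> c) \<beta> = (if \<beta> = \<alpha> then c else 0)"
  by (simp add: mfps_monom_def)

lemma mfps_coeff_monom_mult_add [simp]: "mfps_coeff (mfps_monom \<alpha> c * g) (\<alpha> + \<beta>) = c * mfps_coeff g \<beta>"
proof -
  have "mfps_coeff (mfps_monom \<alpha> c * g) (\<alpha> + \<beta>)
      = (\<Sum>(\<gamma>, \<delta>)\<in>{(\<alpha>, \<beta>)}. mfps_coeff (mfps_monom \<alpha> c) \<gamma> * mfps_coeff g \<delta>)"
    unfolding mfps_coeff_mult
    by (rule sum.mono_neutral_right[OF finite_splits])
       (auto simp: splits_def mfps_coeff_monom split: if_splits)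
  then show ?thesis by (simp add: mfps_coeff_monom)
qed

lemma mfps_coeff_monom_mult_eq_0:
  assumes "\<And>\<beta>. \<gamma> \<noteq> \<alpha> + \<beta>"
  shows "mfps_coeff (mfps_monom \<alpha> c * g) \<gamma> = 0"
  unfolding mfps_coeff_mult
  by (rule sum.neutral) (use assms in \<open>auto simp: splits_def mfps_coeff_monom\<close>)

lemma mfps_monom_mult: "mfps_monom \<alpha> a * mfps_monom \<beta> b = mfps_monom (\<alpha> + \<beta>) (a * b)"
proof (rule mfps_eqI)
  fix \<gamma>
  show "mfps_coeff (mfps_monom \<alpha> a * mfps_monom \<beta> b) \<gamma> = mfps_coeff (mfps_monom (\<alpha> + \<beta>) (a * b)) \<gamma>"
  proof (cases "\<exists>\<delta>. \<gamma> = \<alpha> + \<delta>")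
    case True
    then show ?thesis by (auto simp: mfps_coeff_monom)
  next
    case False
    then show ?thesis by (subst mfps_coeff_monom_mult_eq_0) (auto simp: mfps_coeff_monom)
  qed
qed

lemma mfps_monom_add: "mfps_monom \<alpha> (a + b) = mfps_monom \<alpha> a + mfps_monom \<alpha> b"
  by (rule mfps_eqI) (simp add: mfps_coeff_monom)

lemma mfps_monom_0: "mfps_monom \<alpha> 0 = 0"
  by (rule mfps_eqI) (simp add: mfps_coeff_monom)

lemma mfps_monom_0_1: "mfps_monom 0 1 = 1"
  by (simp add: mfps_monom_def one_mfps_def)

lemma mfps_X_eq_monom: "mfps_X i = mfps_monom (Poly_Mapping.single i 1) 1"
  by (simp add: mfps_X_def mfps_monom_def)

lemma mfps_X_power: "mfps_X i ^ q = mfps_monom (Poly_Mapping.single i q) 1"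
proof (induction q)
  case 0
  then show ?case by (simp add: mfps_monom_0_1)
next
  case (Suc q)
  have "Poly_Mapping.single i 1 + Poly_Mapping.single i q = Poly_Mapping.single i (Suc q)"
    by (simp add: single_add[symmetric])
  then show ?case
    unfolding power_Suc Suc by (simp only: mfps_X_eq_monom mfps_monom_mult mult_1)
qed

section \<open>Ideals containing a power of every variable\<close>

lemma single_add_diff:
  fixes \<alpha> :: "'v \<Rightarrow>\<^sub>0 nat"
  assumes "q \<le> Poly_Mapping.lookup \<alpha> i"
  shows "\<alpha> = Poly_Mapping.single i q + (\<alpha> - Poly_Mapping.single i q)"
  by (rule poly_mapping_eqI) (use assms in \<open>auto simp: lookup_add lookup_minus lookup_single when_def\<close>)

text \<open>Ideals are closed under finite sums only, so the possibly infinitely many terms of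
  \<open>g\<close> are grouped by a variable whose \<open>q\<close>-th power divides them. This
  writes \<open>g\<close> as a finite combination of the \<open>mfps_X j ^ q\<close>.\<close>

lemma mfps_mem_ideal_if_support:
  fixes g :: "('v::finite, 'k::comm_ring_1) mfps"
  assumes J: "ring_ideal.subspace J" and X: "\<And>j. mfps_X j ^ q \<in> J"
    and g: "\<And>\<alpha>. mfps_coeff g \<alpha> \<noteq> 0 \<Longrightarrow> \<exists>j. q \<le> Poly_Mapping.lookup \<alpha> j"
  shows "g \<in> J"
proof -
  \<comment> \<open>Several variables may qualify for one monomial; fixing one of them makes each
    term occur in exactly one cofactor \<open>h j\<close>.\<close>
  define sel where "sel \<alpha> = (SOME j. q \<le> Poly_Mapping.lookup \<alpha> j)" for \<alpha> :: "'v \<Rightarrow>\<^sub>0 nat"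
  have sel: "q \<le> Poly_Mapping.lookup \<alpha> (sel \<alpha>)" if "mfps_coeff g \<alpha> \<noteq> 0" for \<alpha>
    unfolding sel_def using g[OF that] by (rule someI_ex)
  define h where "h j = Abs_mfps (\<lambda>\<beta>. if sel (Poly_Mapping.single j q + \<beta>) = j
      then mfps_coeff g (Poly_Mapping.single j q + \<beta>) else 0)" for j
  have coeff: "mfps_coeff (mfps_X j ^ q * h j) \<alpha> = (if j = sel \<alpha> then mfps_coeff g \<alpha> else 0)" for j \<alpha>
  proof (cases "q \<le> Poly_Mapping.lookup \<alpha> j")
    case True
    define \<beta> where "\<beta> = \<alpha> - Poly_Mapping.single j q"
    have "\<alpha> = Poly_Mapping.single j q + \<beta>"
      unfolding \<beta>_def using True by (rule single_add_diff)
    then show ?thesis by (auto simp: mfps_X_power h_def)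
  next
    case False
    then have "\<alpha> \<noteq> Poly_Mapping.single j q + \<beta>" for \<beta>
      by (auto simp: lookup_add)
    with False sel[of \<alpha>] show ?thesis by (auto simp: mfps_X_power mfps_coeff_monom_mult_eq_0)
  qed
  have "g = (\<Sum>j\<in>UNIV. mfps_X j ^ q * h j)"
    by (rule mfps_eqI) (simp add: mfps_coeff_sum coeff)
  also have "\<dots> \<in> J"
    by (intro ring_ideal.subspace_sum[OF J])
       (use ring_ideal.subspace_scale[OF J X] in \<open>simp add: mult.commute\<close>)
  finally show ?thesis .
qed

section \<open>Truncation and induction on exponents\<close>

lemma finite_bounded_exponents: "finite {\<alpha> :: 'v::finite \<Rightarrow>\<^sub>0 nat. \<forall>j. Poly_Mapping.lookup \<alpha> j < q}"
proof -
  have "finite {h :: 'v \<Rightarrow> nat. \<forall>x. (x \<in> UNIV \<longrightarrow> h x \<in> {..<q}) \<and> (x \<notin> UNIV \<longrightarrow> h x = 0)}"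
    by (rule finite_set_of_finite_funs) auto
  then have "finite (Poly_Mapping.lookup ` {\<alpha> :: 'v \<Rightarrow>\<^sub>0 nat. \<forall>j. Poly_Mapping.lookup \<alpha> j < q})"
    by (rule rev_finite_subset) auto
  then show ?thesis
    by (rule finite_imageD) (auto intro!: inj_onI poly_mapping_eqI)
qed

lemma mfps_coeff_truncate:
  fixes g :: "('v::finite, 'k::comm_ring_1) mfps"
  shows "mfps_coeff (\<Sum>\<beta> | \<forall>j. Poly_Mapping.lookup \<beta> j < q. mfps_monom \<beta> (mfps_coeff g \<beta>)) \<alpha>
    = (if \<forall>j. Poly_Mapping.lookup \<alpha> j < q then mfps_coeff g \<alpha> else 0)"
  by (simp add: mfps_coeff_sum mfps_coeff_monom finite_bounded_exponents)

text \<open>By induction on the total degree: a nonzero exponent vector has a positive entry, which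
  can be lowered by one.\<close>

lemma exponent_induct [case_names zero step]:
  fixes \<alpha> :: "'v::finite \<Rightarrow>\<^sub>0 nat"
  assumes "Q 0" and "\<And>j \<alpha>. Q \<alpha> \<Longrightarrow> Q (Poly_Mapping.single j 1 + \<alpha>)"
  shows "Q \<alpha>"
proof (induction "\<Sum>j\<in>UNIV. Poly_Mapping.lookup \<alpha> j" arbitrary: \<alpha> rule: less_induct)
  case less
  show ?case
  proof (cases "\<alpha> = 0")
    case True
    then show ?thesis using assms(1) by simp
  next
    case False
    then obtain j where j: "1 \<le> Poly_Mapping.lookup \<alpha> j"
      by (metis lookup_zero poly_mapping_eqI less_one not_le)
    define \<beta> where "\<beta> = \<alpha> - Poly_Mapping.single j 1"
    have \<alpha>: "\<alpha> = Poly_Mapping.single j 1 + \<beta>"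
      unfolding \<beta>_def using j by (rule single_add_diff)
    have "(\<Sum>j\<in>UNIV. Poly_Mapping.lookup \<beta> j) < (\<Sum>j\<in>UNIV. Poly_Mapping.lookup \<alpha> j)"
      by (rule sum_strict_mono_ex1) (auto simp: \<alpha> lookup_add intro!: exI[of _ j])
    then have "Q \<beta>" by (rule less)
    then show ?thesis unfolding \<alpha> by (rule assms(2))
  qed
qed

section \<open>Formal partial derivatives\<close>

lemma mfps_coeff_pderiv:
  "mfps_coeff (mfps_pderiv i f) \<alpha>
    = of_nat (Poly_Mapping.lookup \<alpha> i + 1) * mfps_coeff f (Poly_Mapping.single i 1 + \<alpha>)"
  by (simp add: mfps_pderiv_def add.commute)

lemma mfps_pderiv_add: "mfps_pderiv i (f + g) = mfps_pderiv i f + mfps_pderiv i g"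
  by (rule mfps_eqI) (simp add: mfps_coeff_pderiv distrib_left)

lemma mfps_pderiv_const_mult: "mfps_pderiv i (mfps_monom 0 a * g) = mfps_monom 0 a * mfps_pderiv i g"
proof (rule mfps_eqI)
  fix \<alpha>
  have "mfps_coeff (mfps_monom 0 a * h) \<beta> = a * mfps_coeff h \<beta>" for h :: "('a, 'b) mfps" and \<beta>
    using mfps_coeff_monom_mult_add[of 0 a h \<beta>] by simp
  then show "mfps_coeff (mfps_pderiv i (mfps_monom 0 a * g)) \<alpha>
      = mfps_coeff (mfps_monom 0 a * mfps_pderiv i g) \<alpha>"
    by (simp add: mfps_coeff_pderiv mult.left_commute)
qed

text \<open>The instance of the product rule that carries the chain rule from one monomial to the
  next.\<close>

lemma mfps_pderiv_X_mult:
  "mfps_pderiv i (mfps_X j * g) = (if i = j then g else 0) + mfps_X j * mfps_pderiv i g"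
proof (rule mfps_eqI)
  fix \<alpha>
  show "mfps_coeff (mfps_pderiv i (mfps_X j * g)) \<alpha>
      = mfps_coeff ((if i = j then g else 0) + mfps_X j * mfps_pderiv i g) \<alpha>"
  proof (cases "1 \<le> Poly_Mapping.lookup \<alpha> j")
    case True
    define \<beta> where "\<beta> = \<alpha> - Poly_Mapping.single j 1"
    have \<alpha>: "\<alpha> = Poly_Mapping.single j 1 + \<beta>"
      unfolding \<beta>_def using True by (rule single_add_diff)
    have "mfps_coeff (mfps_X j * g) (Poly_Mapping.single i 1 + \<alpha>)
        = mfps_coeff g (Poly_Mapping.single i 1 + \<beta>)"
      unfolding \<alpha> mfps_X_eq_monom add.left_commute[of "Poly_Mapping.single i 1"] by simp
    moreover have "mfps_coeff (mfps_X j * mfps_pderiv i g) \<alpha> = mfps_coeff (mfps_pderiv i g) \<beta>"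
      unfolding \<alpha> mfps_X_eq_monom by simp
    \<comment> \<open>The factor \<alpha>_i + 1 exceeds \<beta>_i + 1 by one exactly when i = j;
      this surplus is the extra summand \<open>g\<close>.\<close>
    ultimately show ?thesis
      by (auto simp: mfps_coeff_pderiv \<alpha> lookup_add lookup_single when_def algebra_simps)
  next
    case False
    then have ne: "\<alpha> \<noteq> Poly_Mapping.single j 1 + \<beta>" for \<beta>
      by (auto simp: lookup_add)
    have 1: "mfps_coeff (mfps_X j * mfps_pderiv i g) \<alpha> = 0"
      unfolding mfps_X_eq_monom using ne by (rule mfps_coeff_monom_mult_eq_0)
    show ?thesis
    proof (cases "i = j")
      case True
      have "mfps_coeff (mfps_X j * g) (Poly_Mapping.single i 1 + \<alpha>) = mfps_coeff g \<alpha>"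
        unfolding True mfps_X_eq_monom by simp
      moreover have "Poly_Mapping.lookup \<alpha> j = 0" using False by simp
      ultimately show ?thesis using True 1 by (simp add: mfps_coeff_pderiv)
    next
      case neq: False
      have "Poly_Mapping.single i 1 + \<alpha> \<noteq> Poly_Mapping.single j 1 + \<beta>" for \<beta>
      proof
        assume "Poly_Mapping.single i 1 + \<alpha> = Poly_Mapping.single j 1 + \<beta>"
        then have "Poly_Mapping.lookup (Poly_Mapping.single i 1 + \<alpha>) j
            = Poly_Mapping.lookup (Poly_Mapping.single j 1 + \<beta>) j" by simp
        then show False using False neq by (simp add: lookup_add lookup_single)
      qed
      then have "mfps_coeff (mfps_X j * g) (Poly_Mapping.single i 1 + \<alpha>) = 0"
        unfolding mfps_X_eq_monom by (rule mfps_coeff_monom_mult_eq_0)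
      then show ?thesis using neq 1 by (simp add: mfps_coeff_pderiv)
    qed
  qed
qed

lemma mfps_pderiv_1: "mfps_pderiv i 1 = 0"
proof (rule mfps_eqI)
  fix \<alpha>
  have "Poly_Mapping.lookup (Poly_Mapping.single i (1 :: nat) + \<alpha>) i \<noteq> 0" by (simp add: lookup_add)
  then have "Poly_Mapping.single i 1 + \<alpha> \<noteq> 0" by (metis lookup_zero)
  then show "mfps_coeff (mfps_pderiv i 1) \<alpha> = mfps_coeff 0 \<alpha>"
    by (simp add: mfps_coeff_pderiv one_mfps_def)
qed

section \<open>The order filtration\<close>

text \<open>This is the \<open>k\<close>-th power of the maximal ideal, described by
  coefficients.\<close>

definition mfps_order_ge :: "nat \<Rightarrow> ('v::finite, 'k::comm_ring_1) mfps set"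
  where "mfps_order_ge k = {g. \<forall>\<alpha>. (\<Sum>i\<in>UNIV. Poly_Mapping.lookup \<alpha> i) < k \<longrightarrow> mfps_coeff g \<alpha> = 0}"

lemma mfps_order_ge_mult:
  assumes "a \<in> mfps_order_ge k" "b \<in> mfps_order_ge l"
  shows "a * b \<in> mfps_order_ge (k + l)"
proof -
  have "mfps_coeff (a * b) \<alpha> = 0" if \<alpha>: "(\<Sum>i\<in>UNIV. Poly_Mapping.lookup \<alpha> i) < k + l" for \<alpha>
    unfolding mfps_coeff_mult
  proof (rule sum.neutral, clarify)
    fix \<beta> \<gamma> assume "(\<beta>, \<gamma>) \<in> splits \<alpha>"
    then have "(\<Sum>i\<in>UNIV. Poly_Mapping.lookup \<beta> i) + (\<Sum>i\<in>UNIV. Poly_Mapping.lookup \<gamma> i) < k + l"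
      using \<alpha> by (auto simp: splits_def lookup_add sum.distrib)
    then have "(\<Sum>i\<in>UNIV. Poly_Mapping.lookup \<beta> i) < k \<or> (\<Sum>i\<in>UNIV. Poly_Mapping.lookup \<gamma> i) < l"
      by linarith
    then show "mfps_coeff a \<beta> * mfps_coeff b \<gamma> = 0"
      using assms by (auto simp: mfps_order_ge_def)
  qed
  then show ?thesis by (simp add: mfps_order_ge_def)
qed

lemma subspace_mfps_order_ge: "ring_ideal.subspace (mfps_order_ge k)"
proof (rule ring_ideal.subspaceI)
  fix a x :: "('a, 'b) mfps" assume "x \<in> mfps_order_ge k"
  moreover have "a \<in> mfps_order_ge 0" by (simp add: mfps_order_ge_def)
  ultimately show "a * x \<in> mfps_order_ge k" using mfps_order_ge_mult by fastforce
qed (auto simp: mfps_order_ge_def)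

lemma mfps_maximal_ideal_subset_order_ge:
  "(mfps_maximal_ideal :: ('v::finite, 'k::comm_ring_1) mfps set) \<subseteq> mfps_order_ge 1"
  unfolding mfps_maximal_ideal_def
proof (rule ring_ideal.span_minimal[OF _ subspace_mfps_order_ge], clarify)
  fix i :: 'v
  have "mfps_coeff (mfps_X i :: ('v, 'k) mfps) \<alpha> = 0" if "(\<Sum>j\<in>UNIV. Poly_Mapping.lookup \<alpha> j) < 1" for \<alpha>
  proof -
    have "Poly_Mapping.lookup \<alpha> i = 0" using that by simp
    then have "\<alpha> \<noteq> Poly_Mapping.single i 1" by auto
    then show ?thesis by (simp add: mfps_X_def)
  qed
  then show "(mfps_X i :: ('v, 'k) mfps) \<in> mfps_order_ge 1" by (simp add: mfps_order_ge_def)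
qed

text \<open>Pigeonhole: if n exponents add up to at least n q, one of them is at least q.\<close>

lemma mfps_order_ge_subset:
  fixes J :: "('v::finite, 'k::comm_ring_1) mfps set"
  assumes "ring_ideal.subspace J" and "\<And>j. mfps_X j ^ q \<in> J"
  shows "mfps_order_ge (card (UNIV :: 'v set) * q) \<subseteq> J"
proof
  fix g :: "('v, 'k) mfps" assume g: "g \<in> mfps_order_ge (card (UNIV :: 'v set) * q)"
  show "g \<in> J"
  proof (rule mfps_mem_ideal_if_support[OF assms])
    fix \<alpha> assume nz: "mfps_coeff g \<alpha> \<noteq> 0"
    show "\<exists>j. q \<le> Poly_Mapping.lookup \<alpha> j"
    proof (rule ccontr)
      assume "\<nexists>j. q \<le> Poly_Mapping.lookup \<alpha> j"
      then have "(\<Sum>j\<in>UNIV. Poly_Mapping.lookup \<alpha> j) < (\<Sum>j\<in>(UNIV :: 'v set). q)"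
        by (intro sum_strict_mono) (auto simp: not_le)
      with g nz show False by (simp add: mfps_order_ge_def)
    qed
  qed
qed

text \<open>A form of Nakayama's lemma. Iterating the inclusion replaces the product term by series
  of ever higher order, and \<open>L\<close> contains all series of sufficiently high order.\<close>

lemma subset_if_subset_plus_maximal_product:
  fixes I L :: "('v::finite, 'k::comm_ring_1) mfps set"
  assumes L: "ring_ideal.subspace L" and X: "\<And>j. mfps_X j ^ q \<in> L"
    and I: "I \<subseteq> L + ideal_product mfps_maximal_ideal I"
  shows "I \<subseteq> L"
proof -
  have "I \<subseteq> L + mfps_order_ge k" for k
  proof (induction k)
    case 0
    have "mfps_order_ge 0 = (UNIV :: ('v, 'k) mfps set)" by (simp add: mfps_order_ge_def)
    moreover have "x = 0 + x" for x :: "('v, 'k) mfps" by simp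
    ultimately show ?case using ring_ideal.subspace_0[OF L] unfolding set_plus_def by blast
  next
    case (Suc k)
    have sub: "ring_ideal.subspace (L + mfps_order_ge (Suc k))"
      by (rule subspace_set_plus[OF L subspace_mfps_order_ge])
    \<comment> \<open>The factor \<open>a\<close> has order at least 1, so it keeps the first
      summand of \<open>b\<close> in \<open>L\<close> and raises the order of the second by
      one.\<close>
    have "a * b \<in> L + mfps_order_ge (Suc k)" if a: "a \<in> mfps_maximal_ideal" and b: "b \<in> I" for a b
    proof -
      from b Suc obtain x y where x: "x \<in> L" and y: "y \<in> mfps_order_ge k" and "b = x + y"
        unfolding set_plus_def by blast
      then have "a * b = a * x + a * y" by (simp add: distrib_left)
      moreover have "a * y \<in> mfps_order_ge (Suc k)"
        using mfps_order_ge_mult[OF _ y, of a 1] a mfps_maximal_ideal_subset_order_ge by auto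
      ultimately show ?thesis using ring_ideal.subspace_scale[OF L x] by (simp add: set_plus_intro)
    qed
    then have prod: "ideal_product mfps_maximal_ideal I \<subseteq> L + mfps_order_ge (Suc k)"
      unfolding ideal_product_def by (intro ring_ideal.span_minimal[OF _ sub]) auto
    have Lsub: "L \<subseteq> L + mfps_order_ge (Suc k)"
      using set_plus_intro[OF _ ring_ideal.subspace_0[OF subspace_mfps_order_ge]] by fastforce
    show ?case
    proof
      fix x assume "x \<in> I"
      with I obtain l p where "l \<in> L" "p \<in> ideal_product mfps_maximal_ideal I" "x = l + p"
        unfolding set_plus_def by blast
      then show "x \<in> L + mfps_order_ge (Suc k)"
        using ring_ideal.subspace_add[OF sub] prod Lsub by blast
    qed
  qed
  \<comment> \<open>The case where \<open>k\<close> is the number of variables times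
    \<open>q\<close>.\<close>
  then have "I \<subseteq> L + L"
    using mfps_order_ge_subset[OF L X] set_plus_mono2[OF order.refl] by (meson order.trans)
  then show ?thesis
    using ring_ideal.subspace_add[OF L] unfolding set_plus_def by blast
qed

section \<open>The Jacobian ideal\<close>

text \<open>Powers of the variables in the Jacobian ideal give finite colength, and properness gives
  a positive trace. The two evaluations of \<open>\<Lambda> f 1\<close>, by the dimension and by the
  chain rule, then contradict each other.\<close>

lemma colon_jacobian_not_subset_tjurina:
  fixes f :: "('v::finite, 'k::field_char_0) mfps"
  assumes X: "\<And>j. mfps_X j ^ p \<in> jacobian_ideal f" and p: "p > 0"
    and proper: "1 \<notin> tjurina_ideal f"
  shows "\<not> colon_ideal (jacobian_ideal f) f \<subseteq> tjurina_ideal f"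
proof
  define J where "J = jacobian_ideal f"
  have J: "ring_ideal.subspace J" unfolding J_def jacobian_ideal_def by (rule ring_ideal.subspace_span)
  have XJ: "mfps_X j ^ p \<in> J" for j using X by (simp add: J_def)
  assume "colon_ideal (jacobian_ideal f) f \<subseteq> tjurina_ideal f"
  then have colon: "colon_ideal J f \<subseteq> J + range (\<lambda>r. f * r)"
    by (simp add: tjurina_ideal_def J_def)
  have proper': "1 \<notin> J + range (\<lambda>r. f * r)"
    using proper by (simp add: tjurina_ideal_def J_def)
  \<comment> \<open>Exponents of the finitely many monomials that span R modulo \<open>J\<close>;
    every other monomial is divisible by some \<open>mfps_X j ^ p\<close>.\<close>
  define E where "E = {\<alpha> :: 'v \<Rightarrow>\<^sub>0 nat. \<forall>j. Poly_Mapping.lookup \<alpha> j < p}"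
  have "finite E" unfolding E_def by (rule finite_bounded_exponents)
  have inj: "inj_on (\<lambda>\<alpha>. mfps_monom \<alpha> (1 :: 'k)) E"
    by (rule inj_onI) (metis mfps_coeff_monom zero_neq_one)
  have spans: "\<exists>c. g - (\<Sum>s\<in>(\<lambda>\<alpha>. mfps_monom \<alpha> 1) ` E. mfps_monom 0 (c s) * s) \<in> J"
    for g :: "('v, 'k) mfps"
  proof
    \<comment> \<open>The spanning set consists of ring elements, so the exponent of a monomial is
      recovered by inverting the injective map from \<open>E\<close>.\<close>
    define c where "c s = mfps_coeff g (inv_into E (\<lambda>\<alpha>. mfps_monom \<alpha> 1) s)" for s :: "('v, 'k) mfps"
    define t where "t = (\<Sum>s\<in>(\<lambda>\<alpha>. mfps_monom \<alpha> 1) ` E. mfps_monom 0 (c s) * s)"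
    have "t = (\<Sum>\<alpha>\<in>E. mfps_monom \<alpha> (mfps_coeff g \<alpha>))"
      unfolding t_def sum.reindex[OF inj]
      by (rule sum.cong) (simp_all add: c_def inv_into_f_f[OF inj] mfps_monom_mult)
    then have "mfps_coeff t \<alpha> = (if \<forall>j. Poly_Mapping.lookup \<alpha> j < p then mfps_coeff g \<alpha> else 0)" for \<alpha>
      by (simp only: E_def mfps_coeff_truncate)
    then have "g - t \<in> J"
      by (intro mfps_mem_ideal_if_support[OF J XJ])
         (auto simp: minus_mfps_def not_less split: if_splits)
    then show "g - (\<Sum>s\<in>(\<lambda>\<alpha>. mfps_monom \<alpha> 1) ` E. mfps_monom 0 (c s) * s) \<in> J"
      by (simp add: t_def)
  qed
  have C_mult: "mfps_monom 0 (a * b) = mfps_monom 0 a * mfps_monom 0 b" for a b :: 'k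
    by (simp add: mfps_monom_mult)
  obtain \<Lambda> :: "('v, 'k) mfps \<Rightarrow> ('v, 'k) mfps \<Rightarrow> 'k" and d where
    add: "\<And>g g' h. \<Lambda> (g + g') h = \<Lambda> g h + \<Lambda> g' h" and
    scale: "\<And>a g h. \<Lambda> (mfps_monom 0 a * g) h = a * \<Lambda> g h" and
    add': "\<And>g h h'. \<Lambda> g (h + h') = \<Lambda> g h + \<Lambda> g h'" and
    scale': "\<And>a g h. \<Lambda> g (mfps_monom 0 a * h) = a * \<Lambda> g h" and
    leibniz: "\<And>g g' h. \<Lambda> (g * g') h = \<Lambda> g (g' * h) + \<Lambda> g' (g * h)" and
    kills: "\<And>g h. h \<in> J \<Longrightarrow> \<Lambda> g h = 0" and
    trace: "\<Lambda> f 1 = of_nat d" "d > 0"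
    by (rule trace_derivation[OF mfps_monom_add C_mult mfps_monom_0_1 J proper' colon
          finite_imageI[OF \<open>finite E\<close>] spans]) (rule that)
  have zero: "\<Lambda> 0 h = 0" for h using add[of 0 0 h] by simp
  have zero': "\<Lambda> g 0 = 0" for g using add'[of g 0 0] by simp
  have kills_mult: "\<Lambda> g (j * h) = 0" if "j \<in> J" for g j h
    using kills ring_ideal.subspace_scale[OF J that, of h] by (simp add: mult.commute)
  \<comment> \<open>The chain rule for the derivation \<open>\<Lambda>\<close>, with values in the
    dual of R/L. No continuity of \<open>\<Lambda>\<close> is at hand, so \<open>f\<close> is split
    into a polynomial, treated by linearity and the product rule, and a tail on which both sides
    vanish.\<close>
  define chain where "chain g \<longleftrightarrow> (\<forall>h. \<Lambda> g h = (\<Sum>i\<in>UNIV. \<Lambda> (mfps_X i) (mfps_pderiv i g * h)))" for g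
  have chain_add: "chain (g + g')" if "chain g" "chain g'" for g g'
    using that by (simp add: chain_def add add' mfps_pderiv_add distrib_right sum.distrib)
  have chain_scale: "chain (mfps_monom 0 a * g)" if "chain g" for a g
    using that by (simp add: chain_def scale scale' mfps_pderiv_const_mult mult.assoc sum_distrib_left)
  have chain_X: "chain (mfps_X j * g)" if "chain g" for j g
  proof -
    \<comment> \<open>The first sum collapses to the summand i = j; the second is the chain rule for
      \<open>g\<close> tested against \<open>mfps_X j * h\<close>. These are the two Leibniz
      terms.\<close>
    have "(\<Sum>i\<in>UNIV. \<Lambda> (mfps_X i) (mfps_pderiv i (mfps_X j * g) * h))
        = (\<Sum>i\<in>UNIV. if i = j then \<Lambda> (mfps_X i) (g * h) else 0)
          + (\<Sum>i\<in>UNIV. \<Lambda> (mfps_X i) (mfps_pderiv i g * (mfps_X j * h)))" for h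
      unfolding sum.distrib[symmetric]
      by (rule sum.cong)
         (simp_all add: mfps_pderiv_X_mult distrib_right add' zero' mult.assoc
            mult.left_commute[of "mfps_X j"])
    then show ?thesis using that by (simp add: chain_def leibniz)
  qed
  have chain_1: "chain 1"
  proof -
    \<comment> \<open>Leibniz for 1 = 1 * 1 makes this value equal to its double.\<close>
    have "\<Lambda> 1 h = 0" for h using leibniz[of 1 1 h] by simp
    then show ?thesis by (simp add: chain_def mfps_pderiv_1 zero')
  qed
  have chain_monom: "chain (mfps_monom \<alpha> 1)" for \<alpha>
  proof (induction \<alpha> rule: exponent_induct)
    case zero
    then show ?case using chain_1 by (simp add: mfps_monom_0_1)
  next
    case (step j \<alpha>)
    then have "chain (mfps_X j * mfps_monom \<alpha> 1)" by (rule chain_X)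
    then show ?case by (simp only: mfps_X_eq_monom mfps_monom_mult mult_1)
  qed
  have chain_poly: "chain (\<Sum>\<alpha>\<in>A. mfps_monom \<alpha> (a \<alpha>))" if "finite A" for A a
    using that
  proof (induction A rule: finite_induct)
    case empty
    have "chain (mfps_monom 0 0 * 1)" using chain_1 by (rule chain_scale)
    then show ?case by (simp add: mfps_monom_0)
  next
    case (insert \<alpha> A)
    have "chain (mfps_monom 0 (a \<alpha>) * mfps_monom \<alpha> 1)" using chain_monom by (rule chain_scale)
    then have "chain (mfps_monom \<alpha> (a \<alpha>))" by (simp add: mfps_monom_mult)
    from chain_add[OF this insert.IH] insert.hyps show ?case by simp
  qed
  have chain_tail: "chain g"
    if g: "\<And>\<alpha>. mfps_coeff g \<alpha> \<noteq> 0 \<Longrightarrow> \<exists>j. 2 * p \<le> Poly_Mapping.lookup \<alpha> j" for g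
  proof -
    \<comment> \<open>Membership in \<open>J\<close> makes \<open>Z\<close> an ideal: in the Leibniz
      rule for \<open>r * x\<close> the term that differentiates \<open>r\<close> carries the factor
      \<open>x\<close>, which must be killed. The exponent is doubled because a product of two
      elements of \<open>J\<close> lies in \<open>Z\<close>, again by Leibniz.\<close>
    define Z where "Z = {g \<in> J. \<forall>h. \<Lambda> g h = 0}"
    have "ring_ideal.subspace Z"
    proof (rule ring_ideal.subspaceI)
      fix r x assume "x \<in> Z"
      then show "r * x \<in> Z"
        using ring_ideal.subspace_scale[OF J] by (auto simp: Z_def leibniz kills_mult)
    qed (use ring_ideal.subspace_0[OF J] ring_ideal.subspace_add[OF J] in \<open>auto simp: Z_def zero add\<close>)
    moreover have "mfps_X j ^ (2 * p) \<in> Z" for j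
      unfolding mult_2 power_add Z_def
      using ring_ideal.subspace_scale[OF J XJ] XJ by (simp add: leibniz kills_mult)
    ultimately have "g \<in> Z" using g by (rule mfps_mem_ideal_if_support)
    moreover have "mfps_pderiv i g \<in> J" for i
    proof (rule mfps_mem_ideal_if_support[OF J XJ])
      fix \<alpha> assume "mfps_coeff (mfps_pderiv i g) \<alpha> \<noteq> 0"
      then have "mfps_coeff g (Poly_Mapping.single i 1 + \<alpha>) \<noteq> 0" by (auto simp: mfps_coeff_pderiv)
      from g[OF this] obtain j where "2 * p \<le> Poly_Mapping.lookup (Poly_Mapping.single i 1 + \<alpha>) j" ..
      \<comment> \<open>Differentiation lowers an exponent by at most one, and 2p - 1 is at least p
        because p > 0.\<close>
      then have "p \<le> Poly_Mapping.lookup \<alpha> j"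
        using p by (auto simp: lookup_add lookup_single when_def split: if_splits)
      then show "\<exists>j. p \<le> Poly_Mapping.lookup \<alpha> j" ..
    qed
    ultimately show ?thesis by (simp add: chain_def Z_def kills_mult)
  qed
  define t where "t = (\<Sum>\<beta> | \<forall>j. Poly_Mapping.lookup \<beta> j < 2 * p. mfps_monom \<beta> (mfps_coeff f \<beta>))"
  have "chain t" unfolding t_def by (rule chain_poly[OF finite_bounded_exponents])
  moreover have "chain (f - t)"
    by (rule chain_tail)
       (auto simp: minus_mfps_def t_def mfps_coeff_truncate not_less split: if_splits)
  ultimately have "chain (t + (f - t))" by (rule chain_add)
  then have "chain f" by simp
  moreover have "mfps_pderiv i f \<in> J" for i
    unfolding J_def jacobian_ideal_def by (rule ring_ideal.span_base) simp
  \<comment> \<open>The products with 1 stay unsimplified so that \<open>kills_mult\<close> matches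
    them.\<close>
  ultimately have "\<Lambda> f 1 = 0" by (simp add: chain_def kills_mult del: mult_1_right)
  with trace show False by simp
qed

section \<open>Reduction from the primary hypothesis\<close>

theorem corollary6p2:
  fixes f :: "('v::finite, 'k::field_char_0) mfps"
  assumes "f \<in> mfps_maximal_ideal"
    and "ideal_primary_to mfps_maximal_ideal (jacobian_ideal f)"
  shows "\<not> colon_ideal (jacobian_ideal f) f
      \<subseteq> tjurina_ideal f + ideal_product mfps_maximal_ideal (colon_ideal (jacobian_ideal f) f)
    \<and> \<not> colon_ideal (jacobian_ideal f) f \<subseteq> tjurina_ideal f"
proof -
  define J where "J = jacobian_ideal f"
  have J: "ring_ideal.subspace J" unfolding J_def jacobian_ideal_def by (rule ring_ideal.subspace_span)
  have T: "ring_ideal.subspace (tjurina_ideal f)"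
    unfolding tjurina_ideal_def using J unfolding J_def by (rule subspace_plus_principal)
  have radical: "ideal_radical J = mfps_maximal_ideal"
    using assms(2) by (simp add: ideal_primary_to_def J_def)
  have "mfps_X i \<in> ideal_radical J" for i
    unfolding radical mfps_maximal_ideal_def by (rule ring_ideal.span_base) simp
  then have "\<forall>i. \<exists>m. mfps_X i ^ m \<in> J" by (simp add: ideal_radical_def)
  then obtain m where m: "\<And>i. mfps_X i ^ m i \<in> J" by metis
  \<comment> \<open>A common exponent for all variables; the successor makes it positive.\<close>
  define p where "p = Suc (\<Sum>i\<in>UNIV. m i)"
  have X: "mfps_X i ^ p \<in> J" for i
  proof -
    have "m i \<le> p" unfolding p_def by (rule le_SucI, rule member_le_sum) auto
    then have "mfps_X i ^ p = mfps_X i ^ (p - m i) * (mfps_X i ^ m i :: ('v, 'k) mfps)"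
      by (simp add: power_add[symmetric])
    then show ?thesis using ring_ideal.subspace_scale[OF J m] by simp
  qed
  have "J \<subseteq> ideal_radical J"
    by (auto simp: ideal_radical_def intro: exI[of _ 1])
  then have JO: "J \<subseteq> mfps_order_ge 1"
    unfolding radical using mfps_maximal_ideal_subset_order_ge by blast
  have fO: "f \<in> mfps_order_ge 1"
    using assms(1) mfps_maximal_ideal_subset_order_ge by blast
  \<comment> \<open>Both \<open>J\<close> and \<open>f\<close> lie in the maximal ideal, so no
    element of the sum has a constant term; this excludes 1.\<close>
  have "tjurina_ideal f \<subseteq> mfps_order_ge 1"
  proof
    fix x assume "x \<in> tjurina_ideal f"
    then obtain j r where "j \<in> J" "x = j + r * f"
      unfolding tjurina_ideal_def plus_principal_iff J_def by (auto simp: mult.commute)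
    then show "x \<in> mfps_order_ge 1"
      using JO ring_ideal.subspace_add[OF subspace_mfps_order_ge]
        ring_ideal.subspace_scale[OF subspace_mfps_order_ge fO] by blast
  qed
  moreover have "(1 :: ('v, 'k) mfps) \<notin> mfps_order_ge 1"
    by (auto simp: mfps_order_ge_def one_mfps_def intro!: exI[of _ 0])
  ultimately have proper: "1 \<notin> tjurina_ideal f" by blast
  have second: "\<not> colon_ideal (jacobian_ideal f) f \<subseteq> tjurina_ideal f"
    by (rule colon_jacobian_not_subset_tjurina[OF X[unfolded J_def] _ proper]) (simp add: p_def)
  have "J \<subseteq> tjurina_ideal f"
  proof
    fix x assume "x \<in> J"
    moreover have "x = x + f * 0" by simp
    ultimately show "x \<in> tjurina_ideal f"
      unfolding tjurina_ideal_def plus_principal_iff J_def by blast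
  qed
  \<comment> \<open>Nakayama's lemma with \<open>tjurina_ideal f\<close> as \<open>L\<close> would
    turn the inclusion with the product term into the plain inclusion already refuted.\<close>
  then have "mfps_X i ^ p \<in> tjurina_ideal f" for i using X by blast
  from subset_if_subset_plus_maximal_product[OF T this] second show ?thesis by blast
qed

end
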